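(* For an integer $n\ge 1$ let $T=\{1,2,\dots,n\}$, let ${\bf L}_T=(\mathrm{lcm}(i,j))_{i,j=1}^n$ and ${\bf G}_T=(\gcd(i,j))_{i,j=1}^n$, and let $\lambda_{n1}\ge\cdots\ge\lambda_{nn}$ be the generalized eigenvalues of ${\bf L}_T$ to ${\bf G}_T$, counted with multiplicity. Then: (i) For $n\le 4$ the generalized eigenvalues are: $\lambda_{11}=1$; $\lambda_{21}=\sqrt{2}$, $\lambda_{22}=-\sqrt{2}$; $\lambda_{31}=\sqrt{6}$, $\lambda_{32}=-1$, $\lambda_{33}=-\sqrt{6}$; $\lambda_{41}=\sqrt{12}$, $\lambda_{42}=\lambda_{43}=-1$, $\lambda_{44}=-\sqrt{12}$. (ii) For every $n>4$, the equalities $\lambda_{n2}=\cdots=\lambda_{n,n-1}=-1$ do not hold (that is, at least one of $\lambda_{n2},\dots,\lambda_{n,n-1}$ is different from $-1$).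
   Context: For complex Hermitian $n\times n$ matrices ${\bf A}$ and ${\bf B}$ with ${\bf B}$ positive definite, a generalized eigenvalue of ${\bf A}$ to ${\bf B}$ is a number $\lambda$ such that ${\bf A}{\bf x}=\lambda{\bf B}{\bf x}$ for some nonzero ${\bf x}\in\mathbb{C}^n$. Equivalently, the generalized eigenvalues are the roots $\lambda$ of $\det({\bf A}-\lambda{\bf B})=0$, counted with multiplicity; there are $n$ of them and all are real. The matrix ${\bf G}_T$ is positive definite. *)

theory Defs
  imports
    "Jordan_Normal_Form.Char_Poly"
    "Jordan_Normal_Form.Conjugate"
    "HOL-Computational_Algebra.Fundamental_Theorem_Algebra"
begin

definition generalized_eigenvalue :: "complex mat \<Rightarrow> complex mat \<Rightarrow> complex \<Rightarrow> bool" where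
  "generalized_eigenvalue A B \<mu> \<longleftrightarrow>
    (\<exists>x \<in> carrier_vec (dim_row A). x \<noteq> 0\<^sub>v (dim_row A) \<and> A *\<^sub>v x = \<mu> \<cdot>\<^sub>v (B *\<^sub>v x))"

text \<open>The polynomial $\det(A - \lambda B)$ in the indeterminate $\lambda$; the matrix entries
  are embedded as constant polynomials.\<close>

definition pencil_poly :: "complex mat \<Rightarrow> complex mat \<Rightarrow> complex poly" where
  "pencil_poly A B = det (map_mat (\<lambda>a. [:a:]) A - [:0, 1:] \<cdot>\<^sub>m map_mat (\<lambda>b. [:b:]) B)"

definition is_generalized_eigenvalue_list :: "complex mat \<Rightarrow> complex mat \<Rightarrow> real list \<Rightarrow> bool" where
  "is_generalized_eigenvalue_list A B ls \<longleftrightarrow>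
    sorted_wrt (\<ge>) ls \<and>
    (\<forall>\<mu>. count (mset (map complex_of_real ls)) \<mu> =
      (if generalized_eigenvalue A B \<mu> then order \<mu> (pencil_poly A B) else 0))"

text \<open>The definite description below is proper for Hermitian A and positive definite B,
  see \<open>ex1_generalized_eigenvalue_list\<close>. The list is indexed from 0, so the
  k-th largest generalized eigenvalue is its entry number k - 1.\<close>

definition generalized_eigenvalues :: "complex mat \<Rightarrow> complex mat \<Rightarrow> real list" where
  "generalized_eigenvalues A B = (THE ls. is_generalized_eigenvalue_list A B ls)"

definition lcm_matrix :: "nat \<Rightarrow> complex mat" where
  "lcm_matrix n = mat n n (\<lambda>(i, j). of_nat (lcm (i + 1) (j + 1)))"

definition gcd_matrix :: "nat \<Rightarrow> complex mat" where
  "gcd_matrix n = mat n n (\<lambda>(i, j). of_nat (gcd (i + 1) (j + 1)))"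

lemma poly_pencil_poly_eq_0_iff:
  assumes A: "A \<in> carrier_mat n n" and B: "B \<in> carrier_mat n n"
  shows "poly (pencil_poly A B) \<mu> = 0 \<longleftrightarrow> generalized_eigenvalue A B \<mu>"
proof -
  have M: "A - \<mu> \<cdot>\<^sub>m B \<in> carrier_mat n n"
    using A B by auto
  have *: "(A - \<mu> \<cdot>\<^sub>m B) *\<^sub>v x = 0\<^sub>v n \<longleftrightarrow> A *\<^sub>v x = \<mu> \<cdot>\<^sub>v (B *\<^sub>v x)"
    if x: "x \<in> carrier_vec n" for x
  proof -
    have "((A - \<mu> \<cdot>\<^sub>m B) *\<^sub>v x) $ i = (A *\<^sub>v x) $ i - (\<mu> \<cdot>\<^sub>v (B *\<^sub>v x)) $ i" if "i < n" for i
      using A B x that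
      by (simp add: scalar_prod_def sum_subtractf sum_distrib_left algebra_simps)
    thus ?thesis
      using A B x by (auto simp: vec_eq_iff)
  qed
  have "poly (pencil_poly A B) \<mu> = det (A - \<mu> \<cdot>\<^sub>m B)"
    unfolding pencil_poly_def
    by (rule poly_det_cong[of _ n]) (use A B in auto)
  moreover have "dim_row A = n"
    using A by simp
  ultimately show ?thesis
    using * det_0_iff_vec_prod_zero[OF M] by (auto simp: generalized_eigenvalue_def)
qed

lemma Hermitian_quadratic_form_real:
  assumes A: "A \<in> carrier_mat n n" and x: "x \<in> carrier_vec n"
    and herm: "\<And>i j. i < n \<Longrightarrow> j < n \<Longrightarrow> A $$ (j, i) = cnj (A $$ (i, j))"
  shows "(A *\<^sub>v x) \<bullet>c x \<in> \<real>"
proof -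
  have eq: "(A *\<^sub>v x) \<bullet>c x = (\<Sum>i<n. \<Sum>j<n. A $$ (i, j) * x $ j * cnj (x $ i))"
    using A x by (simp add: scalar_prod_def sum_distrib_right atLeast0LessThan)
  have "cnj ((A *\<^sub>v x) \<bullet>c x) = (\<Sum>i<n. \<Sum>j<n. A $$ (j, i) * cnj (x $ j) * x $ i)"
    unfolding eq by (simp add: herm[symmetric])
  also have "\<dots> = (\<Sum>j<n. \<Sum>i<n. A $$ (j, i) * cnj (x $ j) * x $ i)"
    by (rule sum.swap)
  also have "\<dots> = (A *\<^sub>v x) \<bullet>c x"
    unfolding eq by (simp add: algebra_simps)
  finally show ?thesis
    by (simp only: Reals_cnj_iff)
qed

lemma generalized_eigenvalue_real:
  assumes A: "A \<in> carrier_mat n n" and B: "B \<in> carrier_mat n n"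
    and herm: "\<And>i j. i < n \<Longrightarrow> j < n \<Longrightarrow> A $$ (j, i) = cnj (A $$ (i, j))"
    and pos: "\<And>x. x \<in> carrier_vec n \<Longrightarrow> x \<noteq> 0\<^sub>v n \<Longrightarrow> 0 < (B *\<^sub>v x) \<bullet>c x"
    and ev: "generalized_eigenvalue A B \<mu>"
  shows "\<mu> \<in> \<real>"
proof -
  from ev A obtain x where x: "x \<in> carrier_vec n" "x \<noteq> 0\<^sub>v n"
    and eq: "A *\<^sub>v x = \<mu> \<cdot>\<^sub>v (B *\<^sub>v x)"
    by (auto simp: generalized_eigenvalue_def)
  define a b where "a = (A *\<^sub>v x) \<bullet>c x" and "b = (B *\<^sub>v x) \<bullet>c x"
  have "a = \<mu> * b"
    unfolding a_def b_def eq using B x by simp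
  moreover have "a \<in> \<real>"
    unfolding a_def by (rule Hermitian_quadratic_form_real[OF A x(1) herm])
  moreover have b: "b \<in> \<real>" "b \<noteq> 0"
    using pos[OF x] unfolding b_def[symmetric] by (auto simp: less_complex_def complex_is_Real_iff)
  ultimately have "\<mu> = a / b" by simp
  thus ?thesis using \<open>a \<in> \<real>\<close> b by simp
qed

lemma ex1_generalized_eigenvalue_list:
  assumes A: "A \<in> carrier_mat n n" and B: "B \<in> carrier_mat n n"
    and herm: "\<And>i j. i < n \<Longrightarrow> j < n \<Longrightarrow> A $$ (j, i) = cnj (A $$ (i, j))"
    and pos: "\<And>x. x \<in> carrier_vec n \<Longrightarrow> x \<noteq> 0\<^sub>v n \<Longrightarrow> 0 < (B *\<^sub>v x) \<bullet>c x"
  shows "\<exists>!ls. is_generalized_eigenvalue_list A B ls"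
proof -
  let ?p = "pencil_poly A B"
  have real: "\<mu> \<in> \<real>" if "poly ?p \<mu> = 0" for \<mu>
    using generalized_eigenvalue_real[OF A B herm pos] that
      poly_pencil_poly_eq_0_iff[OF A B] by blast
  have p: "?p \<noteq> 0"
    using real[of \<i>] by (auto simp: complex_is_Real_iff)
  have "(if generalized_eigenvalue A B \<mu> then order \<mu> ?p else 0) = count (proots ?p) \<mu>" for \<mu>
    using p order_root[of ?p \<mu>] by (simp add: poly_pencil_poly_eq_0_iff[OF A B])
  hence iff: "is_generalized_eigenvalue_list A B ls \<longleftrightarrow>
      sorted_wrt (\<ge>) ls \<and> image_mset complex_of_real (mset ls) = proots ?p" for ls
    by (simp only: is_generalized_eigenvalue_list_def multiset_eq_iff mset_map)
  define ls where "ls = rev (sorted_list_of_multiset (image_mset Re (proots ?p)))"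
  have "image_mset complex_of_real (mset ls) = image_mset (\<lambda>z. complex_of_real (Re z)) (proots ?p)"
    by (simp add: ls_def multiset.map_comp comp_def)
  also have "\<dots> = image_mset (\<lambda>z. z) (proots ?p)"
    using p real by (intro image_mset_cong) auto
  finally have "is_generalized_eigenvalue_list A B ls"
    unfolding iff by (simp add: ls_def sorted_wrt_rev)
  moreover have "ls' = ls" if "is_generalized_eigenvalue_list A B ls'" for ls'
  proof -
    have "image_mset complex_of_real (mset ls') = image_mset complex_of_real (mset ls)"
      using that calculation by (simp add: iff)
    hence "image_mset Re (image_mset complex_of_real (mset ls')) =
        image_mset Re (image_mset complex_of_real (mset ls))"
      by simp
    hence "mset (rev ls') = mset (rev ls)"
      by (simp add: multiset.map_comp comp_def)
    moreover have "sorted (rev ls')" "sorted (rev ls)"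
      using that \<open>is_generalized_eigenvalue_list A B ls\<close> by (simp_all add: iff sorted_wrt_rev)
    ultimately have "rev ls' = rev ls"
      by (metis properties_for_sort)
    thus ?thesis by simp
  qed
  ultimately show ?thesis by blast
qed

end

theory Submission
  imports Defs
    "Jordan_Normal_Form.Jordan_Normal_Form_Existence"
    "Jordan_Normal_Form.Jordan_Normal_Form_Uniqueness"
    "Jordan_Normal_Form.DL_Rank"
    "HOL-Number_Theory.Totient"
begin

text \<open>
  Write $L$ and $G$ for the lcm and gcd matrices. By Gauss's identity $\sum_{d \mid m} \varphi(d) = m$ the form
  of $G$ is a positive combination of squares (\<open>gcd_matrix_pos\<close>), so $G$ is positive definite and the list of
  generalized eigenvalues is the sorted list of the roots of $\det(L - xG)$. For $n \le 4$ this polynomial is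
  $1 - x$, $x^2 - 2$, $-2(x+1)(x^2-6)$ and $4(x+1)^2(x^2-12)$.

  For $n > 4$ suppose that the $n - 2$ middle eigenvalues are all $-1$. Then $-1$ is a root of
  $\det(L - xG)$ of multiplicity at least $n - 2$. For a Hermitian pencil with positive definite $G$ the
  multiplicity of a real root $\mu$ is the dimension of the kernel of $L - \mu G$
  (\<open>order_pencil_poly\<close>), so the kernel of $L + G$ has dimension at least $n - 2$, that is, $L + G$ has rank at
  most 2. This is false, since its principal minor on the indices 2, 3, 5 is $464$. The contradiction is
  drawn without the notion of rank: a kernel of dimension at least $n - 2$ contains a nonzero vector
  supported on these three indices (\<open>kernel_vec_with_support\<close>), while the three corresponding
  equations have only the trivial solution (\<open>kernel_lcm_plus_gcd_support_2_3_5\<close>).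
  The matrix indices are shifted by one: the number $k$ has index $k - 1$.
\<close>

section \<open>Kernels of matrices\<close>

text \<open>
  Padding with zero rows makes the matrix square with vanishing determinant.
\<close>

lemma wide_mat_kernel_nontrivial:
  fixes A :: "'a :: idom mat"
  assumes A: "A \<in> carrier_mat nr nc" and "nr < nc"
  obtains v where "v \<in> carrier_vec nc" "v \<noteq> 0\<^sub>v nc" "A *\<^sub>v v = 0\<^sub>v nr"
proof -
  define M where "M = mat\<^sub>r nc nc (\<lambda>i. if i = nr then 0\<^sub>v nc else if i < nr then row A i else 0\<^sub>v nc)"
  have M: "M \<in> carrier_mat nc nc"
    by (simp add: M_def)
  have "det M = 0"
    unfolding M_def by (rule det_row_0) (use assms in auto)
  then obtain v where v: "v \<in> carrier_vec nc" "v \<noteq> 0\<^sub>v nc" "M *\<^sub>v v = 0\<^sub>v nc"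
    using det_0_iff_vec_prod_zero[OF M] by blast
  have "(A *\<^sub>v v) $ i = 0" if "i < nr" for i
  proof -
    have "row M i = row A i"
      using that assms by (intro eq_vecI) (auto simp: M_def)
    hence "(A *\<^sub>v v) $ i = (M *\<^sub>v v) $ i"
      using that assms M by simp
    thus ?thesis
      using that assms v(3) by simp
  qed
  hence "A *\<^sub>v v = 0\<^sub>v nr"
    using A by (intro eq_vecI) auto
  with v that show ?thesis by blast
qed

lemma zero_mat_mult_vec: "v \<in> carrier_vec nc \<Longrightarrow> 0\<^sub>m nr nc *\<^sub>v v = 0\<^sub>v nr"
  by (rule eq_vecI) auto

lemma mat_mult_zero_vec: "A \<in> carrier_mat nr nc \<Longrightarrow> A *\<^sub>v 0\<^sub>v nc = 0\<^sub>v nr"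
  by (rule eq_vecI) auto

text \<open>
  The columns of \<open>W\<close> are a basis of the kernel, so \<open>W\<close> parametrises the kernel injectively.
  This form trades the abstract vector space of the kernel for plain matrix equations.
\<close>

lemma kernel_dim_basis_mat:
  fixes A :: "'a :: field mat"
  assumes A: "A \<in> carrier_mat nr nc"
  obtains W where "W \<in> carrier_mat nc (kernel_dim A)"
    "\<And>v. v \<in> carrier_vec (kernel_dim A) \<Longrightarrow> A *\<^sub>v (W *\<^sub>v v) = 0\<^sub>v nr"
    "\<And>v. v \<in> carrier_vec (kernel_dim A) \<Longrightarrow> W *\<^sub>v v = 0\<^sub>v nc \<Longrightarrow> v = 0\<^sub>v (kernel_dim A)"
proof -
  interpret K: kernel nr nc A
    by unfold_locales (rule A)
  obtain B where fin: "finite B" and basis: "K.basis B"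
    using kernel_basis_exists[OF A] by blast
  have ker: "B \<subseteq> mat_kernel A" and indpt: "\<not> K.lin_dep B"
    using basis by (auto simp: K.Ker.basis_def)
  have carr: "B \<subseteq> carrier_vec nc"
    using ker mat_kernel_carrier[OF A] by blast
  obtain bs where bs: "set bs = B" "distinct bs"
    using finite_distinct_list[OF fin] by blast
  have len: "length bs = kernel_dim A"
    using K.Ker.dim_basis[OF fin basis] bs distinct_card[of bs] by simp
  define W where "W = mat_of_cols nc bs"
  have W: "W \<in> carrier_mat nc (kernel_dim A)"
    unfolding W_def len[symmetric] by (rule mat_of_cols_carrier)
  have cols: "cols W = bs"
    unfolding W_def using bs carr by (intro cols_mat_of_cols) auto
  have "A * W = 0\<^sub>m nr (kernel_dim A)"
  proof (rule eq_matI)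
    fix i j assume ij: "i < dim_row (0\<^sub>m nr (kernel_dim A) :: 'a mat)"
      "j < dim_col (0\<^sub>m nr (kernel_dim A) :: 'a mat)"
    have "col W j \<in> B"
      using ij W cols_nth[of j W] bs(1) len nth_mem[of j bs] by (simp add: cols)
    hence "A *\<^sub>v col W j = 0\<^sub>v nr"
      using ker mat_kernelD(2)[OF A] by blast
    hence "(A *\<^sub>v col W j) $ i = 0"
      using ij by simp
    thus "(A * W) $$ (i, j) = 0\<^sub>m nr (kernel_dim A) $$ (i, j)"
      using ij A W by simp
  qed (use A W in auto)
  hence "A *\<^sub>v (W *\<^sub>v v) = 0\<^sub>v nr" if "v \<in> carrier_vec (kernel_dim A)" for v
    using assoc_mult_mat_vec[OF A W that] zero_mat_mult_vec[OF that] by simp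
  moreover have "v = 0\<^sub>v (kernel_dim A)"
    if "v \<in> carrier_vec (kernel_dim A)" "W *\<^sub>v v = 0\<^sub>v nc" for v
    using K.NC.lin_depI[OF W that(1) _ that(2)] bs indpt K.lindep_same[OF ker] by (auto simp: cols)
  ultimately show ?thesis
    using W that by blast
qed

text \<open>
  Vanishing outside \<open>I\<close> imposes only \<open>nc - card I\<close> linear conditions on the kernel, which is too few
  to force a vector of the kernel to be zero.
\<close>

lemma kernel_vec_with_support:
  fixes A :: "'a :: field mat"
  assumes A: "A \<in> carrier_mat nr nc" and I: "I \<subseteq> {..<nc}" and card: "nc < kernel_dim A + card I"
  obtains x where "x \<in> carrier_vec nc" "x \<noteq> 0\<^sub>v nc" "A *\<^sub>v x = 0\<^sub>v nr"
    "\<And>i. i < nc \<Longrightarrow> i \<notin> I \<Longrightarrow> x $ i = 0"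
proof -
  obtain W where W: "W \<in> carrier_mat nc (kernel_dim A)"
    and ker: "\<And>v. v \<in> carrier_vec (kernel_dim A) \<Longrightarrow> A *\<^sub>v (W *\<^sub>v v) = 0\<^sub>v nr"
    and inj: "\<And>v. v \<in> carrier_vec (kernel_dim A) \<Longrightarrow> W *\<^sub>v v = 0\<^sub>v nc \<Longrightarrow> v = 0\<^sub>v (kernel_dim A)"
    using kernel_dim_basis_mat[OF A] by metis
  obtain js where js: "set js = {..<nc} - I" "distinct js"
    using finite_distinct_list[of "{..<nc} - I"] by auto
  have "length js = nc - card I"
    using js distinct_card[of js] I by (simp add: card_Diff_subset finite_subset)
  moreover have "card I \<le> nc"
    using card_mono[OF _ I] by simp
  ultimately have len: "length js < kernel_dim A"
    using card by linarith
  define R where "R = mat (length js) (kernel_dim A) (\<lambda>(k, j). W $$ (js ! k, j))"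
  have "R \<in> carrier_mat (length js) (kernel_dim A)"
    by (simp add: R_def)
  then obtain v where v: "v \<in> carrier_vec (kernel_dim A)" "v \<noteq> 0\<^sub>v (kernel_dim A)"
    "R *\<^sub>v v = 0\<^sub>v (length js)"
    using wide_mat_kernel_nontrivial len by metis
  have "(W *\<^sub>v v) $ i = 0" if i: "i < nc" "i \<notin> I" for i
  proof -
    obtain k where k: "k < length js" "js ! k = i"
      using i js(1) by (metis DiffI in_set_conv_nth lessThan_iff)
    have "row R k = row W i"
      using k i W by (intro eq_vecI) (auto simp: R_def)
    hence "(W *\<^sub>v v) $ i = (R *\<^sub>v v) $ k"
      using k i W by (simp add: R_def)
    thus ?thesis
      using v(3) k by simp
  qed
  thus ?thesis
    using that[of "W *\<^sub>v v"] ker inj v W by fastforce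
qed

section \<open>Multiplicities for Hermitian pencils\<close>

text \<open>
  Any power at least as large as every Jordan block annihilates the generalized eigenspace;
  one more than the sum of the block sizes is such a power, and being a successor it also suits the
  comparison of \<open>N ^\<^sub>m Suc k\<close> with \<open>N\<close> in \<open>order_pencil_poly\<close>.
\<close>

lemma jordan_nf_order_eq_dim_gen_eigenspace:
  assumes jnf: "jordan_nf A n_as"
  shows "Polynomial.order \<mu> (char_poly A) = dim_gen_eigenspace A \<mu> (Suc (sum_list (map fst n_as)))"
proof -
  have "min (Suc (sum_list (map fst n_as))) k = k" if "k \<in> set (map fst n_as)" for k
    using member_le_sum_list[OF that] by linarith
  hence "map (min (Suc (sum_list (map fst n_as)))) (map fst [(n, e)\<leftarrow>n_as . e = \<mu>])
      = map fst [(n, e)\<leftarrow>n_as . e = \<mu>]"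
    by (intro map_idI) auto
  moreover have "[(n, e)\<leftarrow>n_as . e = \<mu>] = filter (\<lambda>na. snd na = \<mu>) n_as"
    by (intro filter_cong) auto
  ultimately show ?thesis
    unfolding jordan_nf_order[OF jnf] dim_gen_eigenspace[OF jnf] by (simp only:)
qed

text \<open>
  With \<open>C = inverse B * A\<close> the pencil factors as $A - xB = B (C - x)$, which makes the theory of
  characteristic polynomials and Jordan normal forms available for pencils.
\<close>

lemma pencil_poly_eq_char_poly:
  fixes A B :: "complex mat"
  assumes "A \<in> carrier_mat n n" "B \<in> carrier_mat n n" "det B \<noteq> 0"
  obtains C c where "C \<in> carrier_mat n n" "c \<noteq> 0" "pencil_poly A B = Polynomial.smult c (char_poly C)"
    "\<And>x. B * char_matrix C x = A - x \<cdot>\<^sub>m B"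
proof -
  note A = assms(1) and B = assms(2)
  obtain B' where B': "B' \<in> carrier_mat n n" "B * B' = 1\<^sub>m n"
    using det_non_zero_imp_unit[OF B assms(3), of "()"]
    by (auto simp: Units_def ring_mat_simps)
  define C where "C = B' * A"
  have C: "C \<in> carrier_mat n n"
    using A B' by (simp add: C_def)
  have BC: "B * C = A"
    unfolding C_def using A B B' by (simp flip: assoc_mult_mat)
  have char: "B * char_matrix C x = A - x \<cdot>\<^sub>m B" for x
  proof -
    have "B * char_matrix C x = B * C + B * ((-x) \<cdot>\<^sub>m 1\<^sub>m n)"
      unfolding char_matrix_def using B C by (simp add: mult_add_distrib_mat)
    also have "\<dots> = A + (-x) \<cdot>\<^sub>m B"
      using B BC mult_smult_distrib[OF B one_carrier_mat, of "- x"] by simp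
    also have "\<dots> = A - x \<cdot>\<^sub>m B"
      using A B by (intro eq_matI) auto
    finally show ?thesis .
  qed
  have "poly (pencil_poly A B) x = poly (Polynomial.smult (det (- B)) (char_poly C)) x" for x
  proof -
    have "poly (pencil_poly A B) x = det (A - x \<cdot>\<^sub>m B)"
      unfolding pencil_poly_def by (rule poly_det_cong[of _ n]) (use A B in auto)
    also have "A - x \<cdot>\<^sub>m B = (- B) * (- char_matrix C x)"
      unfolding char[symmetric]
      by (rule eq_matI) (use B char_matrix_closed[OF C, of x] in
          \<open>auto simp: scalar_prod_def intro!: sum.cong\<close>)
    also have "det \<dots> = det (- B) * det (- char_matrix C x)"
      by (rule det_mult[of _ n]) (use B C in auto)
    finally show ?thesis
      by (simp add: char_poly_matrix[OF C])
  qed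
  hence "pencil_poly A B = Polynomial.smult (det (- B)) (char_poly C)"
    using poly_eq_poly_eq_iff by blast
  moreover have "det (- B) \<noteq> 0"
    using assms(3) det_0_negate[OF B] by simp
  ultimately show ?thesis
    using that C char by blast
qed

lemma Hermitian_mult_vec_adjoint:
  assumes A: "A \<in> carrier_mat n n" and x: "x \<in> carrier_vec n" and y: "y \<in> carrier_vec n"
    and herm: "\<And>i j. i < n \<Longrightarrow> j < n \<Longrightarrow> A $$ (j, i) = cnj (A $$ (i, j))"
  shows "(A *\<^sub>v x) \<bullet>c y = x \<bullet>c (A *\<^sub>v y)"
proof -
  have "(A *\<^sub>v x) \<bullet>c y = (\<Sum>i<n. \<Sum>j<n. A $$ (i, j) * x $ j * cnj (y $ i))"
    using A x y by (simp add: scalar_prod_def sum_distrib_right atLeast0LessThan)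
  also have "\<dots> = (\<Sum>j<n. \<Sum>i<n. A $$ (i, j) * x $ j * cnj (y $ i))"
    by (rule sum.swap)
  also have "\<dots> = (\<Sum>j<n. x $ j * cnj (\<Sum>i<n. A $$ (j, i) * y $ i))"
    by (auto simp: sum_distrib_left herm[symmetric] algebra_simps intro!: sum.cong)
  also have "\<dots> = x \<bullet>c (A *\<^sub>v y)"
    using A x y by (simp add: scalar_prod_def atLeast0LessThan)
  finally show ?thesis .
qed

lemma det_nonzero_of_pos:
  fixes B :: "complex mat"
  assumes B: "B \<in> carrier_mat n n"
    and pos: "\<And>x. x \<in> carrier_vec n \<Longrightarrow> x \<noteq> 0\<^sub>v n \<Longrightarrow> 0 < (B *\<^sub>v x) \<bullet>c x"
  shows "det B \<noteq> 0"
proof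
  assume "det B = 0"
  then obtain x where "x \<in> carrier_vec n" "x \<noteq> 0\<^sub>v n" "B *\<^sub>v x = 0\<^sub>v n"
    using det_0_iff_vec_prod_zero[OF B] by blast
  with pos[of x] show False
    by simp
qed

text \<open>
  Algebraic and geometric multiplicity agree, as for Hermitian matrices: $N = B^{-1}A - \mu$ is
  self-adjoint for the inner product defined by $B$, so $\langle BNx, Nx\rangle = \langle x, BN^2x\rangle$, and $N^2x = 0$
  forces $Nx = 0$. Hence all powers of $N$ have the kernel of $N$, which is that of $BN = A - \mu B$.
\<close>

lemma order_pencil_poly:
  assumes A: "A \<in> carrier_mat n n" and B: "B \<in> carrier_mat n n"
    and hermA: "\<And>i j. i < n \<Longrightarrow> j < n \<Longrightarrow> A $$ (j, i) = cnj (A $$ (i, j))"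
    and hermB: "\<And>i j. i < n \<Longrightarrow> j < n \<Longrightarrow> B $$ (j, i) = cnj (B $$ (i, j))"
    and pos: "\<And>x. x \<in> carrier_vec n \<Longrightarrow> x \<noteq> 0\<^sub>v n \<Longrightarrow> 0 < (B *\<^sub>v x) \<bullet>c x"
    and \<mu>: "\<mu> \<in> \<real>"
  shows "Polynomial.order \<mu> (pencil_poly A B) = kernel_dim (A - \<mu> \<cdot>\<^sub>m B)"
proof -
  obtain C c where C: "C \<in> carrier_mat n n" and c: "c \<noteq> 0"
    and pencil: "pencil_poly A B = Polynomial.smult c (char_poly C)"
    and BN: "\<And>x. B * char_matrix C x = A - x \<cdot>\<^sub>m B"
    using pencil_poly_eq_char_poly[OF A B det_nonzero_of_pos[OF B pos]] by blast
  define N where "N = char_matrix C \<mu>"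
  define H where "H = A - \<mu> \<cdot>\<^sub>m B"
  have N: "N \<in> carrier_mat n n" and H: "H \<in> carrier_mat n n"
    using A B C by (auto simp: N_def H_def)
  have BN: "B *\<^sub>v (N *\<^sub>v x) = H *\<^sub>v x" if "x \<in> carrier_vec n" for x
    using assoc_mult_mat_vec[OF B N that] by (simp add: N_def H_def BN)
  have hermH: "H $$ (j, i) = cnj (H $$ (i, j))" if "i < n" "j < n" for i j
    using that A B \<mu> by (simp add: H_def hermA[of i j] hermB[of i j] Reals_cnj_iff)
  have square: "N *\<^sub>v x = 0\<^sub>v n" if x: "x \<in> carrier_vec n" and "N *\<^sub>v (N *\<^sub>v x) = 0\<^sub>v n" for x
  proof (rule ccontr)
    assume nz: "N *\<^sub>v x \<noteq> 0\<^sub>v n"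
    have Nx: "N *\<^sub>v x \<in> carrier_vec n"
      using N x by simp
    have "(B *\<^sub>v (N *\<^sub>v x)) \<bullet>c (N *\<^sub>v x) = x \<bullet>c (H *\<^sub>v (N *\<^sub>v x))"
      unfolding BN[OF x] by (rule Hermitian_mult_vec_adjoint[OF H x Nx hermH])
    also have "H *\<^sub>v (N *\<^sub>v x) = 0\<^sub>v n"
      using BN[OF Nx] that(2) mat_mult_zero_vec[OF B] by simp
    finally have "(B *\<^sub>v (N *\<^sub>v x)) \<bullet>c (N *\<^sub>v x) = 0"
      using x by simp
    with pos[OF Nx nz] show False
      by simp
  qed
  have pow: "N *\<^sub>v x = 0\<^sub>v n"
    if "x \<in> carrier_vec n" "N ^\<^sub>m Suc k *\<^sub>v x = 0\<^sub>v n" for k x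
    using that
  proof (induction k arbitrary: x)
    case 0
    thus ?case using N by simp
  next
    case (Suc k)
    have Nx: "N *\<^sub>v x \<in> carrier_vec n"
      using N Suc.prems by simp
    have "N ^\<^sub>m Suc (Suc k) *\<^sub>v x = N ^\<^sub>m Suc k *\<^sub>v (N *\<^sub>v x)"
      using assoc_mult_mat_vec[OF pow_carrier_mat[OF N, of "Suc k"] N Suc.prems(1)] by simp
    hence "N *\<^sub>v (N *\<^sub>v x) = 0\<^sub>v n"
      using Suc.IH[OF Nx] Suc.prems(2) by metis
    thus ?case
      using square Suc.prems(1) by blast
  qed
  have kernel: "mat_kernel (N ^\<^sub>m Suc k) = mat_kernel H" for k
  proof -
    have "N ^\<^sub>m Suc k *\<^sub>v x = 0\<^sub>v n \<longleftrightarrow> N *\<^sub>v x = 0\<^sub>v n" if x: "x \<in> carrier_vec n" for x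
    proof
      assume "N *\<^sub>v x = 0\<^sub>v n"
      thus "N ^\<^sub>m Suc k *\<^sub>v x = 0\<^sub>v n"
        using assoc_mult_mat_vec[OF pow_carrier_mat[OF N, of k] N x]
          mat_mult_zero_vec[OF pow_carrier_mat[OF N, of k]] by simp
    qed (use pow x in blast)
    moreover have "N *\<^sub>v x = 0\<^sub>v n \<longleftrightarrow> H *\<^sub>v x = 0\<^sub>v n" if x: "x \<in> carrier_vec n" for x
    proof
      assume "N *\<^sub>v x = 0\<^sub>v n"
      thus "H *\<^sub>v x = 0\<^sub>v n"
        using BN[OF x] mat_mult_zero_vec[OF B] by simp
    next
      assume "H *\<^sub>v x = 0\<^sub>v n"
      thus "N *\<^sub>v x = 0\<^sub>v n"
        using pos[of "N *\<^sub>v x"] BN[OF x] N x by auto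
    qed
    ultimately show ?thesis
      using mat_kernel[OF pow_carrier_mat[OF N, of "Suc k"]] mat_kernel[OF H] by blast
  qed
  obtain n_as where jnf: "jordan_nf C n_as"
    using char_poly_factorized[OF C] jordan_nf_exists[OF C] by blast
  have "Polynomial.order \<mu> (pencil_poly A B) = Polynomial.order \<mu> (char_poly C)"
    using c by (simp add: pencil order_smult)
  also have "\<dots> = kernel_dim (N ^\<^sub>m Suc (sum_list (map fst n_as)))"
    by (simp only: jordan_nf_order_eq_dim_gen_eigenspace[OF jnf] dim_gen_eigenspace_def N_def)
  also have "\<dots> = kernel_dim H"
    unfolding kernel_dim_def kernel using N H pow_carrier_mat[OF N] by (simp del: pow_mat.simps)
  finally show ?thesis
    by (simp add: H_def)
qed

lemma is_generalized_eigenvalue_list_iff_proots: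
  assumes A: "A \<in> carrier_mat n n" and B: "B \<in> carrier_mat n n" and p: "pencil_poly A B \<noteq> 0"
  shows "is_generalized_eigenvalue_list A B ls \<longleftrightarrow>
    sorted_wrt (\<ge>) ls \<and> image_mset complex_of_real (mset ls) = proots (pencil_poly A B)"
proof -
  have "(if generalized_eigenvalue A B \<mu> then Polynomial.order \<mu> (pencil_poly A B) else 0)
      = count (proots (pencil_poly A B)) \<mu>" for \<mu>
    using p order_root[of "pencil_poly A B" \<mu>] by (simp add: poly_pencil_poly_eq_0_iff[OF A B])
  thus ?thesis
    by (simp only: is_generalized_eigenvalue_list_def multiset_eq_iff mset_map)
qed

section \<open>Lcm and gcd matrices\<close>

lemma gcd_matrix_carrier: "gcd_matrix n \<in> carrier_mat n n"
  and lcm_matrix_carrier: "lcm_matrix n \<in> carrier_mat n n"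
  by (simp_all add: gcd_matrix_def lcm_matrix_def)

lemma gcd_matrix_Hermitian: "i < n \<Longrightarrow> j < n \<Longrightarrow> gcd_matrix n $$ (j, i) = cnj (gcd_matrix n $$ (i, j))"
  and lcm_matrix_Hermitian: "i < n \<Longrightarrow> j < n \<Longrightarrow> lcm_matrix n $$ (j, i) = cnj (lcm_matrix n $$ (i, j))"
  by (simp_all add: gcd_matrix_def lcm_matrix_def gcd.commute lcm.commute)

text \<open>
  Gauss's identity $\sum_{d \mid m} \varphi(d) = m$, applied to $m = \gcd(i+1, j+1)$. The summation range depends on
  neither index, so that the identity reads as a factorisation $E^T \mathrm{diag}(\varphi) E$ of the gcd matrix.
\<close>

lemma gcd_eq_sum_totient:
  assumes "i < n"
  shows "gcd (Suc i) (Suc j) =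
    (\<Sum>d<n. if Suc d dvd Suc i \<and> Suc d dvd Suc j then totient (Suc d) else 0)"
proof -
  have "gcd (Suc i) (Suc j) = (\<Sum>d | d dvd gcd (Suc i) (Suc j). totient d)"
    by (rule totient_divisor_sum[symmetric])
  also have "{d. d dvd gcd (Suc i) (Suc j)} = Suc ` {d. d < n \<and> Suc d dvd Suc i \<and> Suc d dvd Suc j}"
  proof (intro equalityI subsetI)
    fix d assume "d \<in> {d. d dvd gcd (Suc i) (Suc j)}"
    hence d: "d dvd Suc i" "d dvd Suc j" by auto
    hence "d \<noteq> 0" "d \<le> Suc i"
      by (metis dvd_0_left nat.distinct(1)) (use d in \<open>auto dest: dvd_imp_le\<close>)
    then obtain e where "d = Suc e" "e < n"
      using assms by (cases d) auto
    with d show "d \<in> Suc ` {d. d < n \<and> Suc d dvd Suc i \<and> Suc d dvd Suc j}"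
      by auto
  qed auto
  also have "(\<Sum>d\<in>\<dots>. totient d) =
      (\<Sum>d | d < n \<and> Suc d dvd Suc i \<and> Suc d dvd Suc j. totient (Suc d))"
    by (subst sum.reindex) auto
  also have "\<dots> = (\<Sum>d<n. if Suc d dvd Suc i \<and> Suc d dvd Suc j then totient (Suc d) else 0)"
    by (subst sum.inter_filter[symmetric]) auto
  finally show ?thesis .
qed

text \<open>
  The factorisation turns the quadratic form into $\sum_d \varphi(d) |y_d|^2$, where $y_d$ is the sum of the
  entries of $x$ at the multiples of $d$. If $m$ is the last index at which $x$ does not vanish, then
  $y_m$ consists of a single nonzero term.
\<close>

lemma gcd_matrix_pos:
  assumes x: "x \<in> carrier_vec n" "x \<noteq> 0\<^sub>v n"
  shows "0 < (gcd_matrix n *\<^sub>v x) \<bullet>c x"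
proof -
  define y where "y d = (\<Sum>i<n. if Suc d dvd Suc i then x $ i else 0)" for d
  have "(gcd_matrix n *\<^sub>v x) \<bullet>c x
      = (\<Sum>i<n. \<Sum>j<n. of_nat (gcd (Suc i) (Suc j)) * x $ j * cnj (x $ i))"
    using x(1) by (simp add: gcd_matrix_def scalar_prod_def sum_distrib_right atLeast0LessThan)
  also have "\<dots> = (\<Sum>i<n. \<Sum>j<n. \<Sum>d<n. of_nat (totient (Suc d))
      * (if Suc d dvd Suc j then x $ j else 0) * cnj (if Suc d dvd Suc i then x $ i else 0))"
    by (intro sum.cong refl, subst gcd_eq_sum_totient[of _ n])
      (auto simp: sum_distrib_right intro!: sum.cong)
  also have "\<dots> = (\<Sum>i<n. \<Sum>d<n. \<Sum>j<n. of_nat (totient (Suc d))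
      * (if Suc d dvd Suc j then x $ j else 0) * cnj (if Suc d dvd Suc i then x $ i else 0))"
    by (rule sum.cong[OF refl], rule sum.swap)
  also have "\<dots> = (\<Sum>d<n. \<Sum>i<n. \<Sum>j<n. of_nat (totient (Suc d))
      * (if Suc d dvd Suc j then x $ j else 0) * cnj (if Suc d dvd Suc i then x $ i else 0))"
    by (rule sum.swap)
  also have "\<dots> = (\<Sum>d<n. of_nat (totient (Suc d)) * (cnj (y d) * y d))"
    unfolding y_def cnj_sum sum_product by (simp add: sum_distrib_left mult_ac)
  also have "\<dots> = complex_of_real (\<Sum>d<n. real (totient (Suc d)) * (cmod (y d))\<^sup>2)"
    unfolding of_real_sum of_real_mult complex_norm_square by (simp add: mult.commute)
  finally have eq: "(gcd_matrix n *\<^sub>v x) \<bullet>c x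
      = complex_of_real (\<Sum>d<n. real (totient (Suc d)) * (cmod (y d))\<^sup>2)" .
  (* no proper multiple of m + 1 contributes to y m *)
  define m where "m = Max {i. i < n \<and> x $ i \<noteq> 0}"
  have "{i. i < n \<and> x $ i \<noteq> 0} \<noteq> {}"
    using x by (auto simp: vec_eq_iff)
  hence m: "m < n" "x $ m \<noteq> 0" and max: "\<And>i. i < n \<Longrightarrow> x $ i \<noteq> 0 \<Longrightarrow> i \<le> m"
    using Max_in[of "{i. i < n \<and> x $ i \<noteq> 0}"] by (auto simp: m_def)
  have "y m = (\<Sum>i<n. if i = m then x $ m else 0)"
    unfolding y_def by (intro sum.cong) (auto dest: dvd_imp_le max intro: le_antisym)
  hence "y m = x $ m"
    using m by simp
  hence "0 < real (totient (Suc m)) * (cmod (y m))\<^sup>2"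
    using m by simp
  hence "0 < (\<Sum>d<n. real (totient (Suc d)) * (cmod (y d))\<^sup>2)"
    using m by (intro sum_pos2[of _ m]) auto
  thus ?thesis
    by (simp add: eq less_complex_def)
qed

lemma generalized_eigenvalues_lcm_gcd:
  "is_generalized_eigenvalue_list (lcm_matrix n) (gcd_matrix n)
    (generalized_eigenvalues (lcm_matrix n) (gcd_matrix n))"
  unfolding generalized_eigenvalues_def
  by (rule theI')
    (rule ex1_generalized_eigenvalue_list[OF lcm_matrix_carrier gcd_matrix_carrier
        lcm_matrix_Hermitian gcd_matrix_pos])

lemma generalized_eigenvalues_lcm_gcd_eqI:
  assumes sorted: "sorted_wrt (\<ge>) ls" and c: "c \<noteq> 0"
    and det: "\<And>x. det (lcm_matrix n - x \<cdot>\<^sub>m gcd_matrix n) = c * (\<Prod>a\<leftarrow>ls. x - complex_of_real a)"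
  shows "generalized_eigenvalues (lcm_matrix n) (gcd_matrix n) = ls"
proof -
  let ?p = "pencil_poly (lcm_matrix n) (gcd_matrix n)"
  let ?q = "Polynomial.smult c (\<Prod>a\<leftarrow>ls. [:- complex_of_real a, 1:])"
  have "poly ?p x = poly ?q x" for x
  proof -
    have "poly ?p x = det (lcm_matrix n - x \<cdot>\<^sub>m gcd_matrix n)"
      unfolding pencil_poly_def
      by (rule poly_det_cong[of _ n]) (use lcm_matrix_carrier[of n] gcd_matrix_carrier[of n] in auto)
    thus ?thesis
      by (simp add: det poly_prod_list comp_def)
  qed
  hence p: "?p = ?q"
    using poly_eq_poly_eq_iff by blast
  have nz: "(\<Prod>a\<leftarrow>as. [:- complex_of_real a, 1:]) \<noteq> 0" for as
    by (auto simp: prod_list_zero_iff)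
  have "proots (\<Prod>a\<leftarrow>as. [:- complex_of_real a, 1:]) = mset (map complex_of_real as)" for as
  proof (induction as)
    case (Cons a as)
    have "proots (\<Prod>b\<leftarrow>a # as. [:- complex_of_real b, 1:]) =
        proots [:- complex_of_real a, 1:] + proots (\<Prod>b\<leftarrow>as. [:- complex_of_real b, 1:])"
      unfolding list.map prod_list.Cons by (rule proots_mult[OF _ nz]) simp
    thus ?case
      unfolding Cons.IH by simp
  qed simp
  hence "is_generalized_eigenvalue_list (lcm_matrix n) (gcd_matrix n) ls"
    using sorted c nz by (subst is_generalized_eigenvalue_list_iff_proots[of _ n])
      (simp_all add: p lcm_matrix_carrier gcd_matrix_carrier)
  with generalized_eigenvalues_lcm_gcd[of n] show ?thesis
    using ex1_generalized_eigenvalue_list[OF lcm_matrix_carrier gcd_matrix_carrier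
        lcm_matrix_Hermitian gcd_matrix_pos, of n] by blast
qed

lemma generalized_eigenvalues_image_mset:
  "image_mset complex_of_real (mset (generalized_eigenvalues (lcm_matrix n) (gcd_matrix n))) =
    proots (pencil_poly (lcm_matrix n) (gcd_matrix n))"
  and length_generalized_eigenvalues: "length (generalized_eigenvalues (lcm_matrix n) (gcd_matrix n)) = n"
proof -
  let ?p = "pencil_poly (lcm_matrix n) (gcd_matrix n)"
  obtain C c where C: "C \<in> carrier_mat n n" and c: "c \<noteq> 0" and p: "?p = Polynomial.smult c (char_poly C)"
    using pencil_poly_eq_char_poly[OF lcm_matrix_carrier gcd_matrix_carrier
        det_nonzero_of_pos[OF gcd_matrix_carrier gcd_matrix_pos]] by metis
  have "degree (char_poly C) = n" "char_poly C \<noteq> 0"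
    using degree_monic_char_poly[OF C] by auto
  hence "degree ?p = n" "?p \<noteq> 0"
    using c by (simp_all add: p)
  thus *: "image_mset complex_of_real (mset (generalized_eigenvalues (lcm_matrix n) (gcd_matrix n))) = proots ?p"
    using generalized_eigenvalues_lcm_gcd[of n]
      is_generalized_eigenvalue_list_iff_proots[OF lcm_matrix_carrier gcd_matrix_carrier] by blast
  show "length (generalized_eigenvalues (lcm_matrix n) (gcd_matrix n)) = n"
    using arg_cong[OF *, of size] \<open>degree ?p = n\<close> by (simp add: size_proots_complex)
qed

section \<open>The eigenvalues for at most four numbers\<close>

lemma det_mat_Suc:
  fixes f :: "nat \<times> nat \<Rightarrow> 'a :: comm_ring_1"
  shows "det (mat (Suc n) (Suc n) f) =
    (\<Sum>j<Suc n. (-1) ^ j * f (0, j) *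
      det (mat n n (\<lambda>(a, b). f (Suc a, if b < j then b else Suc b))))"
proof -
  have "mat_delete (mat (Suc n) (Suc n) f) 0 j =
      mat n n (\<lambda>(a, b). f (Suc a, if b < j then b else Suc b))" for j
    by (rule eq_matI) (auto simp: mat_delete_def)
  thus ?thesis
    by (subst laplace_expansion_row[of _ "Suc n" 0])
      (auto simp: cofactor_def mult_ac intro!: sum.cong)
qed

lemma det_mat_0: "det (mat 0 0 f) = 1"
  by (rule det_dim_zero) simp

lemma det_mat_2:
  fixes f :: "nat \<times> nat \<Rightarrow> 'a :: comm_ring_1"
  shows "det (mat 2 2 f) =
   f (0,0) * f (1,1) - f (0,1) * f (1,0)"
  by (simp add: det_mat_Suc det_mat_0 numeral_3_eq_3 numeral_2_eq_2 algebra_simps)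

lemma det_mat_3:
  fixes f :: "nat \<times> nat \<Rightarrow> 'a :: comm_ring_1"
  shows "det (mat 3 3 f) =
   f (0,0) * (f (1,1) * f (2,2) - f (1,2) * f (2,1))
   - f (0,1) * (f (1,0) * f (2,2) - f (1,2) * f (2,0))
   + f (0,2) * (f (1,0) * f (2,1) - f (1,1) * f (2,0))"
  by (simp add: det_mat_Suc det_mat_0 numeral_3_eq_3 numeral_2_eq_2 algebra_simps)

lemma det_mat_4:
  fixes f :: "nat \<times> nat \<Rightarrow> 'a :: comm_ring_1"
  shows "det (mat 4 4 f) =
     f (0, 0) * det (mat 3 3 (\<lambda>(a, b). f (Suc a, Suc b)))
   - f (0, 1) * det (mat 3 3 (\<lambda>(a, b). f (Suc a, if b < 1 then b else Suc b)))
   + f (0, 2) * det (mat 3 3 (\<lambda>(a, b). f (Suc a, if b < 2 then b else Suc b)))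
   - f (0, 3) * det (mat 3 3 (\<lambda>(a, b). f (Suc a, if b < 3 then b else Suc b)))"
proof -
  have "{..<Suc 3} = {0, 1, 2, 3}"
    by auto
  thus ?thesis
    using det_mat_Suc[of 3 f] by simp
qed

lemma lcm_gcd_pencil_eq_mat:
  "lcm_matrix n - x \<cdot>\<^sub>m gcd_matrix n =
    mat n n (\<lambda>(i, j). of_nat (lcm (Suc i) (Suc j)) - x * of_nat (gcd (Suc i) (Suc j)))"
  by (rule eq_matI) (auto simp: lcm_matrix_def gcd_matrix_def)

lemma gcd_nat_numerals: "gcd 2 3 = (1::nat)" "gcd 3 4 = (1::nat)" "gcd 2 4 = (2::nat)"
  "gcd 2 5 = (1::nat)" "gcd 3 5 = (1::nat)"
  "gcd 3 2 = (1::nat)" "gcd 4 3 = (1::nat)" "gcd 4 2 = (2::nat)"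
  "gcd 5 2 = (1::nat)" "gcd 5 3 = (1::nat)"
  by (simp_all add: gcd_non_0_nat)

lemma lcm_nat_numerals: "lcm 2 3 = (6::nat)" "lcm 3 4 = (12::nat)" "lcm 2 4 = (4::nat)"
   "lcm 2 5 = (10::nat)" "lcm 3 5 = (15::nat)"
   "lcm 3 2 = (6::nat)" "lcm 4 3 = (12::nat)" "lcm 4 2 = (4::nat)"
   "lcm 5 2 = (10::nat)" "lcm 5 3 = (15::nat)"
  by (simp_all add: lcm_nat_def gcd_nat_numerals)

lemma det_lcm_gcd_pencil_1:
  "det (lcm_matrix 1 - x \<cdot>\<^sub>m gcd_matrix 1) = 1 - x"
  by (simp add: lcm_gcd_pencil_eq_mat det_mat_Suc det_mat_0)

lemma det_lcm_gcd_pencil_2: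
  "det (lcm_matrix 2 - x \<cdot>\<^sub>m gcd_matrix 2) = (x^2 - 2)"
  by (simp add: lcm_gcd_pencil_eq_mat det_mat_2 algebra_simps power2_eq_square)

lemma det_lcm_gcd_pencil_3:
  "det (lcm_matrix 3 - x \<cdot>\<^sub>m gcd_matrix 3) = - 2 * ((x + 1) * (x^2 - 6))"
  by (simp add: lcm_gcd_pencil_eq_mat det_mat_3 gcd_nat_numerals lcm_nat_numerals
      numeral_2_eq_2[symmetric] algebra_simps power2_eq_square)

lemma det_lcm_gcd_pencil_4:
  "det (lcm_matrix 4 - x \<cdot>\<^sub>m gcd_matrix 4) = 4 * ((x + 1)^2 * (x^2 - 12))"
proof -
  note numerals = gcd_nat_numerals lcm_nat_numerals numeral_2_eq_2[symmetric]
  (* the entries are evaluated before distributing, to keep the 24 products small *)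
  show ?thesis
    apply (simp add: lcm_gcd_pencil_eq_mat det_mat_4 det_mat_3 numerals)
    apply (simp add: algebra_simps power2_eq_square)
    done
qed

lemma square_minus_numeral_factor:
  "x ^ 2 - numeral a =
    (x - complex_of_real (sqrt (numeral a))) * (x + complex_of_real (sqrt (numeral a)))"
proof -
  have "complex_of_real (sqrt (numeral a)) * complex_of_real (sqrt (numeral a)) = numeral a"
    by (simp flip: of_real_mult)
  thus ?thesis
    by (simp add: algebra_simps power2_eq_square)
qed

lemma generalized_eigenvalues_1: "generalized_eigenvalues (lcm_matrix 1) (gcd_matrix 1) = [1]"
  by (rule generalized_eigenvalues_lcm_gcd_eqI[of _ "-1"]) (simp_all only: det_lcm_gcd_pencil_1, simp_all)

lemma generalized_eigenvalues_2:
  "generalized_eigenvalues (lcm_matrix 2) (gcd_matrix 2) = [sqrt 2, - sqrt 2]"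
proof (rule generalized_eigenvalues_lcm_gcd_eqI[of _ 1])
  show "det (lcm_matrix 2 - x \<cdot>\<^sub>m gcd_matrix 2) =
      1 * (\<Prod>a\<leftarrow>[sqrt 2, - sqrt 2]. x - complex_of_real a)" for x
    unfolding det_lcm_gcd_pencil_2 square_minus_numeral_factor by simp
qed simp_all

lemma generalized_eigenvalues_3:
  "generalized_eigenvalues (lcm_matrix 3) (gcd_matrix 3) = [sqrt 6, - 1, - sqrt 6]"
proof (rule generalized_eigenvalues_lcm_gcd_eqI[of _ "- 2"])
  have "0 \<le> sqrt 6"
    by simp
  hence "- 1 \<le> sqrt 6"
    by linarith
  thus "sorted_wrt (\<ge>) [sqrt 6, - 1, - sqrt 6]"
    by simp
  show "det (lcm_matrix 3 - x \<cdot>\<^sub>m gcd_matrix 3) =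
      - 2 * (\<Prod>a\<leftarrow>[sqrt 6, - 1, - sqrt 6]. x - complex_of_real a)" for x
    unfolding det_lcm_gcd_pencil_3 square_minus_numeral_factor by simp
qed simp_all

lemma generalized_eigenvalues_4:
  "generalized_eigenvalues (lcm_matrix 4) (gcd_matrix 4) = [sqrt 12, - 1, - 1, - sqrt 12]"
proof (rule generalized_eigenvalues_lcm_gcd_eqI[of _ 4])
  have "0 \<le> sqrt 12"
    by simp
  hence "- 1 \<le> sqrt 12"
    by linarith
  thus "sorted_wrt (\<ge>) [sqrt 12, - 1, - 1, - sqrt 12]"
    by simp
  show "det (lcm_matrix 4 - x \<cdot>\<^sub>m gcd_matrix 4) =
      4 * (\<Prod>a\<leftarrow>[sqrt 12, - 1, - 1, - sqrt 12]. x - complex_of_real a)" for x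
    unfolding det_lcm_gcd_pencil_4 square_minus_numeral_factor by (simp add: power2_eq_square)
qed simp_all

section \<open>The multiplicity of $-1$ for more than four numbers\<close>

text \<open>
  The entries of $L + G$ with indices in $\{2, 3, 5\}$ form the nonsingular matrix with rows
  $(4, 7, 11)$, $(7, 6, 16)$, $(11, 16, 10)$. The choice matters: the entries with indices in $\{1, 2, 5\}$,
  for example, form a singular matrix.
\<close>

lemma kernel_lcm_plus_gcd_support_2_3_5:
  assumes n: "4 < n" and x: "x \<in> carrier_vec n" "(lcm_matrix n + gcd_matrix n) *\<^sub>v x = 0\<^sub>v n"
    and supp: "\<And>i. i < n \<Longrightarrow> i \<notin> {1, 2, 4} \<Longrightarrow> x $ i = 0"
  shows "x = 0\<^sub>v n"
proof -
  let ?s = "\<lambda>i j. complex_of_nat (lcm (Suc i) (Suc j) + gcd (Suc i) (Suc j))"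
  have row: "?s i 1 * x $ 1 + ?s i 2 * x $ 2 + ?s i 4 * x $ 4 = 0" if "i < n" for i
  proof -
    have "0 = ((lcm_matrix n + gcd_matrix n) *\<^sub>v x) $ i"
      using that by (simp add: x(2))
    also have "\<dots> = (\<Sum>j<n. ?s i j * x $ j)"
      using that x(1) by (simp add: lcm_matrix_def gcd_matrix_def scalar_prod_def atLeast0LessThan)
    also have "\<dots> = (\<Sum>j\<in>{1, 2, 4}. ?s i j * x $ j)"
      by (rule sum.mono_neutral_right) (use n supp in auto)
    finally show ?thesis
      by (simp add: add.assoc)
  qed
  have "4 * x $ 1 + 7 * x $ 2 + 11 * x $ 4 = 0"
    "7 * x $ 1 + 6 * x $ 2 + 16 * x $ 4 = 0"
    "11 * x $ 1 + 16 * x $ 2 + 10 * x $ 4 = 0"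
    using row[of 1] row[of 2] row[of 4] n
    by (simp_all add: gcd_nat_numerals lcm_nat_numerals numeral_2_eq_2[symmetric])
  (* Cramer's rule: the coefficients are the cofactors, 464 is the determinant *)
  moreover have
    "464 * a = - 196 * (4 * a + 7 * b + 11 * c) + 106 * (7 * a + 6 * b + 16 * c)
      + 46 * (11 * a + 16 * b + 10 * c)"
    "464 * b = 106 * (4 * a + 7 * b + 11 * c) - 81 * (7 * a + 6 * b + 16 * c)
      + 13 * (11 * a + 16 * b + 10 * c)"
    "464 * c = 46 * (4 * a + 7 * b + 11 * c) + 13 * (7 * a + 6 * b + 16 * c)
      - 25 * (11 * a + 16 * b + 10 * c)" for a b c :: complex
    by (simp_all add: algebra_simps)
  ultimately have "464 * x $ 1 = 0" "464 * x $ 2 = 0" "464 * x $ 4 = 0"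
    by (metis add_0 diff_zero mult_zero_right)+
  hence "x $ i = 0" if "i < n" for i
    using supp that by (cases "i \<in> {1, 2, 4}") auto
  thus ?thesis
    using x(1) by (intro eq_vecI) auto
qed

text \<open>
  A larger multiplicity would make the kernel of $L + G$ so large that it meets the three-dimensional
  space of the vectors supported on the indices 2, 3, 5.
\<close>

lemma multiplicity_minus_one_le:
  assumes n: "4 < n"
  shows "Polynomial.order (-1) (pencil_poly (lcm_matrix n) (gcd_matrix n)) + 3 \<le> n"
proof (rule ccontr)
  assume large: "\<not> ?thesis"
  let ?S = "lcm_matrix n + gcd_matrix n"
  have S: "?S \<in> carrier_mat n n"
    using lcm_matrix_carrier[of n] gcd_matrix_carrier[of n] by auto
  have "lcm_matrix n - (- 1) \<cdot>\<^sub>m gcd_matrix n = ?S"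
    by (rule eq_matI) (auto simp: lcm_matrix_def gcd_matrix_def)
  hence "Polynomial.order (-1) (pencil_poly (lcm_matrix n) (gcd_matrix n)) = kernel_dim ?S"
    using order_pencil_poly[OF lcm_matrix_carrier gcd_matrix_carrier lcm_matrix_Hermitian
        gcd_matrix_Hermitian gcd_matrix_pos, of n "-1"] by simp
  hence "n < kernel_dim ?S + card {1, 2, 4 :: nat}"
    using large by simp
  then obtain x where "x \<in> carrier_vec n" "x \<noteq> 0\<^sub>v n" "?S *\<^sub>v x = 0\<^sub>v n"
    "\<And>i. i < n \<Longrightarrow> i \<notin> {1, 2, 4} \<Longrightarrow> x $ i = 0"
    using kernel_vec_with_support[OF S, of "{1, 2, 4}"] n by auto
  with kernel_lcm_plus_gcd_support_2_3_5[OF n] show False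
    by blast
qed

lemma middle_eigenvalues_not_all_minus_one:
  assumes n: "4 < n"
  shows "\<exists>k\<in>{2..n - 1}. generalized_eigenvalues (lcm_matrix n) (gcd_matrix n) ! (k - 1) \<noteq> - 1"
proof (rule ccontr)
  let ?ls = "generalized_eigenvalues (lcm_matrix n) (gcd_matrix n)"
  let ?p = "pencil_poly (lcm_matrix n) (gcd_matrix n)"
  assume "\<not> ?thesis"
  hence eq: "?ls ! (k - 1) = - 1" if "k \<in> {2..n - 1}" for k
    using that by blast
  have "{1..n - 2} \<subseteq> {i. i < length ?ls \<and> ?ls ! i = - 1}"
    using eq[of "Suc i" for i] by (force simp: length_generalized_eigenvalues)
  hence "n - 2 \<le> card {i. i < length ?ls \<and> ?ls ! i = - 1}"
    using card_mono[of "{i. i < length ?ls \<and> ?ls ! i = - 1}" "{1..n - 2}"] by simp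
  also have "\<dots> = count (image_mset complex_of_real (mset ?ls)) (- 1)"
    unfolding mset_map[symmetric] count_mset count_list_eq_length_filter length_filter_conv_card
    by (intro arg_cong[of _ _ card]) (auto simp: complex_eq_iff)
  also have "\<dots> = count (proots ?p) (- 1)"
    by (simp add: generalized_eigenvalues_image_mset)
  also have "\<dots> \<le> Polynomial.order (- 1) ?p"
    by (cases "?p = 0") auto
  finally show False
    using multiplicity_minus_one_le[OF n] n by linarith
qed

theorem mainTheorem2:
  fixes lam :: "nat \<Rightarrow> real list"
  defines "lam \<equiv> \<lambda>n. generalized_eigenvalues (lcm_matrix n) (gcd_matrix n)"
  shows "lam 1 = [1] \<and>
         lam 2 = [sqrt 2, - sqrt 2] \<and>
         lam 3 = [sqrt 6, - 1, - sqrt 6] \<and>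
         lam 4 = [sqrt 12, - 1, - 1, - sqrt 12] \<and>
         (\<forall>n>4. \<not> (\<forall>k\<in>{2..n - 1}. lam n ! (k - 1) = - 1))"
  unfolding lam_def
  using generalized_eigenvalues_1 generalized_eigenvalues_2 generalized_eigenvalues_3
    generalized_eigenvalues_4 middle_eigenvalues_not_all_minus_one
  by blast

end
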